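(* Let $R$ be a Lie nilpotent ring. If the (completely) prime ideals of $R$ are finitely generated as left ideals, then every (left) ideal of $R$ containing the prime radical $\mathrm{rad}(R)$ is finitely generated as a left ideal.
   Context: Rings are associative. For elements $x,y$ of a ring, $[x,y]=xy-yx$. Left normed commutators are defined by $[x_1]_1^*=x_1$ and $[x_1,\ldots,x_{k+1}]_{k+1}^*=[[x_1,\ldots,x_k]_k^*,x_{k+1}]$. A ring $R$ is Lie nilpotent of index $n$ (has property $\mathrm{L}_n$), $n\ge 1$, if $[x_1,\ldots,x_{n+1}]_{n+1}^*=0$ for all $x_1,\ldots,x_{n+1}\in R$; it is Lie nilpotent if it is Lie nilpotent of index $n$ for some $n\geq 1$. A prime ideal is a proper two-sided ideal $P$ such that for two-sided ideals $A,B$, $AB\subseteq P$ implies $A\subseteq P$ or $B\subseteq P$; a proper two-sided ideal $P$ is completely prime if, for elements $a,b\in R$, $ab\in P$ implies $a\in P$ or $b\in P$. In a Lie nilpotent ring all prime ideals are completely prime, which is why "completely" is in parentheses; also, all left ideals containing $\mathrm{rad}(R)$ are two-sided ideals, which is why "left" is in parentheses. $\mathrm{rad}(R)$ denotes the prime (lower nil) radical of $R$, i.e. the intersection of all prime ideals of $R$. *)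

theory Defs
  imports "HOL-Algebra.Ideal_Product"
begin

definition ring_commutator :: "('a, 'b) ring_scheme \<Rightarrow> 'a \<Rightarrow> 'a \<Rightarrow> 'a" where
  "ring_commutator R x y = (x \<otimes>\<^bsub>R\<^esub> y) \<ominus>\<^bsub>R\<^esub> (y \<otimes>\<^bsub>R\<^esub> x)"

text \<open>Indices are shifted by one: \<open>left_normed_commutator R x k\<close> is the left normed commutator
  of the \<open>k + 1\<close> elements \<open>x 0, \<dots>, x k\<close>.\<close>

primrec left_normed_commutator :: "('a, 'b) ring_scheme \<Rightarrow> (nat \<Rightarrow> 'a) \<Rightarrow> nat \<Rightarrow> 'a" where
  "left_normed_commutator R x 0 = x 0"
| "left_normed_commutator R x (Suc k) =
     ring_commutator R (left_normed_commutator R x k) (x (Suc k))"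

definition lie_nilpotent_of_index :: "('a, 'b) ring_scheme \<Rightarrow> nat \<Rightarrow> bool" where
  "lie_nilpotent_of_index R n \<longleftrightarrow>
     (\<forall>x. (\<forall>i\<le>n. x i \<in> carrier R) \<longrightarrow> left_normed_commutator R x n = \<zero>\<^bsub>R\<^esub>)"

definition lie_nilpotent :: "('a, 'b) ring_scheme \<Rightarrow> bool" where
  "lie_nilpotent R \<longleftrightarrow> (\<exists>n\<ge>1. lie_nilpotent_of_index R n)"

locale left_ideal = additive_subgroup I R + ring R for I and R (structure) +
  assumes l_closed: "\<lbrakk>a \<in> I; x \<in> carrier R\<rbrakk> \<Longrightarrow> x \<otimes> a \<in> I"

definition gen_left_ideal :: "('a, 'b) ring_scheme \<Rightarrow> 'a set \<Rightarrow> 'a set" where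
  "gen_left_ideal R S = \<Inter>{I. left_ideal I R \<and> S \<subseteq> I}"

definition fin_gen_left_ideal :: "('a, 'b) ring_scheme \<Rightarrow> 'a set \<Rightarrow> bool" where
  "fin_gen_left_ideal R I \<longleftrightarrow>
     (\<exists>S. finite S \<and> S \<subseteq> carrier R \<and> I = gen_left_ideal R S)"

text \<open>The library's \<open>primeideal\<close> is restricted to commutative rings and is defined elementwise,
  so it does not serve here.\<close>

definition prime_ideal :: "('a, 'b) ring_scheme \<Rightarrow> 'a set \<Rightarrow> bool" where
  "prime_ideal R P \<longleftrightarrow>
     ideal P R \<and> P \<noteq> carrier R \<and>
     (\<forall>A B. ideal A R \<longrightarrow> ideal B R \<longrightarrow> A \<cdot>\<^bsub>R\<^esub> B \<subseteq> P \<longrightarrow> A \<subseteq> P \<or> B \<subseteq> P)"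

definition completely_prime_ideal :: "('a, 'b) ring_scheme \<Rightarrow> 'a set \<Rightarrow> bool" where
  "completely_prime_ideal R P \<longleftrightarrow>
     ideal P R \<and> P \<noteq> carrier R \<and>
     (\<forall>a\<in>carrier R. \<forall>b\<in>carrier R. a \<otimes>\<^bsub>R\<^esub> b \<in> P \<longrightarrow> a \<in> P \<or> b \<in> P)"

text \<open>Intersecting with the carrier only matters for the zero ring, which has no prime ideals.\<close>

definition prime_radical :: "('a, 'b) ring_scheme \<Rightarrow> 'a set" where
  "prime_radical R = {x \<in> carrier R. \<forall>P. prime_ideal R P \<longrightarrow> x \<in> P}"

end

theory Submission
  imports Defs
begin

text \<open>
  If every commutator of length \<open>n + 1\<close> vanishes modulo a prime ideal and \<open>n \<ge> 2\<close>, then each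
  \<open>c = [u, y]\<close> of length \<open>n\<close> is central modulo that ideal, and
  \<open>[[u, u y], y] = u [c, y] + c\<^sup>2\<close> shows that \<open>c\<^sup>2\<close>, hence also \<open>c\<close>, lies in it. Descending
  on \<open>n\<close>, \<open>R\<close> is commutative modulo each prime ideal, hence modulo the prime radical. The
  commutative proof of Cohen's theorem then applies: a left ideal that is maximal among those
  containing the prime radical and not finitely generated is completely prime.
\<close>

context ring
begin

section \<open>Left ideals and their generation\<close>

lemma left_ideal_iff:
  "left_ideal I R \<longleftrightarrow> I \<subseteq> carrier R \<and> \<zero> \<in> I \<and> (\<forall>a\<in>I. \<forall>b\<in>I. a \<oplus> b \<in> I) \<and>
     (\<forall>a\<in>I. \<forall>x\<in>carrier R. x \<otimes> a \<in> I)" (is "_ \<longleftrightarrow> ?r")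
proof
  assume "left_ideal I R"
  then interpret left_ideal I R .
  show ?r using a_subset l_closed by auto
next
  assume r: ?r
  \<comment> \<open>Absorbing the factor -1 from the left supplies the additive inverses, which the
    criterion does not list.\<close>
  have "\<ominus> a \<in> I" if "a \<in> I" for a
  proof -
    have "(\<ominus> \<one>) \<otimes> a \<in> I" using r that by blast
    moreover have "(\<ominus> \<one>) \<otimes> a = \<ominus> a" using r that l_minus[of \<one> a] by auto
    ultimately show ?thesis by simp
  qed
  then have "subgroup I (add_monoid R)"
    using r by (auto intro!: add.subgroupI simp: a_inv_def)
  then show "left_ideal I R"
    using r ring_axioms
    by (auto intro!: left_ideal.intro additive_subgroup.intro left_ideal_axioms.intro)
qed

lemma left_ideal_diff:
  assumes "left_ideal I R" "a \<in> I" "b \<in> I"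
  shows "a \<ominus> b \<in> I"
proof -
  interpret left_ideal I R by fact
  show ?thesis using assms by (simp add: a_minus_def)
qed

lemma ideal_iff_left_ideal:
  "ideal I R \<longleftrightarrow> left_ideal I R \<and> (\<forall>a\<in>I. \<forall>x\<in>carrier R. a \<otimes> x \<in> I)"
  by (auto simp: ideal_def left_ideal_def ideal_axioms_def left_ideal_axioms_def ring_axioms)

text \<open>This keeps the family intersected in \<open>gen_left_ideal\<close> nonempty for
  \<open>S\<close> inside the carrier, so the generated left ideal stays inside the carrier
  too.\<close>

lemma left_ideal_carrier: "left_ideal (carrier R) R"
  by (auto simp: left_ideal_iff)

lemma left_ideal_gen:
  assumes "S \<subseteq> carrier R"
  shows "left_ideal (gen_left_ideal R S) R"
  using assms left_ideal_carrier
  by (auto simp: left_ideal_iff gen_left_ideal_def)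

lemma gen_left_ideal_superset: "S \<subseteq> gen_left_ideal R S"
  by (auto simp: gen_left_ideal_def)

lemma gen_left_ideal_least: "left_ideal I R \<Longrightarrow> S \<subseteq> I \<Longrightarrow> gen_left_ideal R S \<subseteq> I"
  by (auto simp: gen_left_ideal_def)

lemma fin_gen_carrier: "fin_gen_left_ideal R (carrier R)"
proof -
  let ?G = "gen_left_ideal R {\<one>}"
  have G: "left_ideal ?G R" "\<one> \<in> ?G"
    using left_ideal_gen gen_left_ideal_superset[of "{\<one>}"] by auto
  then have "x \<in> ?G" if "x \<in> carrier R" for x
    using that r_one[of x] unfolding left_ideal_iff by metis
  with G have "carrier R = ?G" by (auto simp: left_ideal_iff)
  then show ?thesis
    unfolding fin_gen_left_ideal_def by (intro exI[of _ "{\<one>}"]) auto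
qed

section \<open>Cohen's argument: \<open>I + R a\<close>, the colon ideal and maximal
  counterexamples\<close>

lemma left_ideal_add_principal:
  assumes I: "left_ideal I R" and a: "a \<in> carrier R"
  shows "left_ideal {x \<oplus> r \<otimes> a |x r. x \<in> I \<and> r \<in> carrier R} R" (is "left_ideal ?J R")
  unfolding left_ideal_iff
proof (intro conjI ballI)
  note I' = I[unfolded left_ideal_iff]
  show "?J \<subseteq> carrier R" using I' a by auto
  have "\<zero> = \<zero> \<oplus> \<zero> \<otimes> a" using a by simp
  then show "\<zero> \<in> ?J" using I' by blast
  fix p assume "p \<in> ?J"
  then obtain x r where x: "p = x \<oplus> r \<otimes> a" "x \<in> I" "r \<in> carrier R" by auto
  have xR: "x \<in> carrier R" using x I' by auto
  {
    fix q assume "q \<in> ?J"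
    then obtain y s where y: "q = y \<oplus> s \<otimes> a" "y \<in> I" "s \<in> carrier R" by auto
    have yR: "y \<in> carrier R" using y I' by auto
    have "p \<oplus> q = (x \<oplus> y) \<oplus> (r \<oplus> s) \<otimes> a"
      using x y xR yR a by (simp add: l_distr a_ac)
    moreover have "x \<oplus> y \<in> I" "r \<oplus> s \<in> carrier R" using x y I' by auto
    ultimately show "p \<oplus> q \<in> ?J" by blast
  }
  fix s assume s: "s \<in> carrier R"
  have "s \<otimes> p = s \<otimes> x \<oplus> (s \<otimes> r) \<otimes> a"
    using x xR s a by (simp add: r_distr m_assoc)
  moreover have "s \<otimes> x \<in> I" "s \<otimes> r \<in> carrier R" using x s I' by auto
  ultimately show "s \<otimes> p \<in> ?J" by blast
qed

lemma left_ideal_colon: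
  assumes "left_ideal I R" and "a \<in> carrier R"
  shows "left_ideal {r \<in> carrier R. r \<otimes> a \<in> I} R"
  using assms by (auto simp: left_ideal_iff l_distr m_assoc)

text \<open>The step of Cohen's theorem: \<open>I\<close> is generated by the \<open>I\<close>-parts of generators of \<open>I + R a\<close>
  together with \<open>j a\<close> for generators \<open>j\<close> of the colon ideal.\<close>

lemma fin_gen_of_add_principal_and_colon:
  assumes I: "left_ideal I R" and a: "a \<in> carrier R"
    and sum: "fin_gen_left_ideal R {x \<oplus> r \<otimes> a |x r. x \<in> I \<and> r \<in> carrier R}"
    and colon: "fin_gen_left_ideal R {r \<in> carrier R. r \<otimes> a \<in> I}"
  shows "fin_gen_left_ideal R I"
proof -
  let ?J = "{r \<in> carrier R. r \<otimes> a \<in> I}"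
  let ?M = "\<lambda>K. {x \<oplus> r \<otimes> a |x r. x \<in> K \<and> r \<in> carrier R}"
  from sum obtain F where F: "finite F" "F \<subseteq> carrier R" "?M I = gen_left_ideal R F"
    unfolding fin_gen_left_ideal_def by blast
  from colon obtain E where E: "finite E" "E \<subseteq> carrier R" "?J = gen_left_ideal R E"
    unfolding fin_gen_left_ideal_def by blast
  have IR: "I \<subseteq> carrier R" using I by (simp add: left_ideal_iff)
  \<comment> \<open>Each generator of \<open>I + R a\<close> is split; \<open>p s\<close> will be
    its chosen \<open>I\<close>-part.\<close>
  have "\<forall>s\<in>F. \<exists>x. \<exists>r. x \<in> I \<and> r \<in> carrier R \<and> s = x \<oplus> r \<otimes> a"
    using F gen_left_ideal_superset[of F] by blast
  then obtain p where p: "\<forall>s\<in>F. \<exists>r. p s \<in> I \<and> r \<in> carrier R \<and> s = p s \<oplus> r \<otimes> a"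
    by metis
  define T where "T = p ` F \<union> (\<lambda>j. j \<otimes> a) ` E"
  define G where "G = gen_left_ideal R T"
  have "E \<subseteq> ?J" using E gen_left_ideal_superset[of E] by simp
  then have T: "T \<subseteq> I" "finite T" using p F E by (auto simp: T_def)
  have G: "left_ideal G R" "T \<subseteq> G"
    unfolding G_def using T IR left_ideal_gen gen_left_ideal_superset by auto
  have GI: "G \<subseteq> I" unfolding G_def using gen_left_ideal_least I T by blast
  \<comment> \<open>Since \<open>G\<close> contains every \<open>p s\<close>, the generators of
    \<open>I + R a\<close> already lie in \<open>G + R a\<close>, so the two sums coincide.\<close>
  have "F \<subseteq> ?M G"
  proof
    fix s assume s: "s \<in> F"
    then have "p s \<in> G" using G by (auto simp: T_def)
    then show "s \<in> ?M G" using s p by blast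
  qed
  then have M: "?M I \<subseteq> ?M G"
    unfolding F(3) by (intro gen_left_ideal_least left_ideal_add_principal G(1) a)
  have "E \<subseteq> {r \<in> carrier R. r \<otimes> a \<in> G}" using E(2) G(2) by (auto simp: T_def)
  then have J: "?J \<subseteq> {r \<in> carrier R. r \<otimes> a \<in> G}"
    unfolding E(3) by (intro gen_left_ideal_least left_ideal_colon G(1) a)
  \<comment> \<open>Write \<open>x = g + r a\<close> with \<open>g\<close> in \<open>G\<close>. Then
    \<open>r a = x - g\<close> lies in \<open>I\<close>, so \<open>r\<close> is in the colon ideal
    \<open>?J\<close>, and every element of \<open>?J\<close> multiplies \<open>a\<close> into
    \<open>G\<close>.\<close>
  have "x \<in> G" if x: "x \<in> I" for x
  proof -
    have "x = x \<oplus> \<zero> \<otimes> a" using x IR a by auto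
    then have "x \<in> ?M I" using x by blast
    then obtain g r where g: "x = g \<oplus> r \<otimes> a" "g \<in> G" "r \<in> carrier R" using M by blast
    have "g \<in> carrier R" using g GI IR by auto
    then have "r \<otimes> a = x \<ominus> g" using g a by (simp add: a_minus_def a_ac r_neg1 r_neg2)
    also have "\<dots> \<in> I" using left_ideal_diff[OF I] x g GI by blast
    finally have "r \<otimes> a \<in> G" using J g by blast
    then show ?thesis using g G by (auto simp: left_ideal_iff)
  qed
  then have "I = gen_left_ideal R T" using GI G_def by blast
  then show ?thesis unfolding fin_gen_left_ideal_def using T IR by blast
qed

text \<open>Zorn's lemma applies because a finite generating set of the union of a chain already
  lies in one member, which would then equal the union and be finitely generated itself.\<close>

lemma exists_maximal_not_fin_gen:
  assumes L: "left_ideal L R" "\<not> fin_gen_left_ideal R L"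
  shows "\<exists>P. left_ideal P R \<and> L \<subseteq> P \<and> \<not> fin_gen_left_ideal R P \<and>
    (\<forall>I. left_ideal I R \<and> P \<subset> I \<longrightarrow> fin_gen_left_ideal R I)"
proof -
  let ?A = "{I. left_ideal I R \<and> L \<subseteq> I \<and> \<not> fin_gen_left_ideal R I}"
  have "\<exists>P\<in>?A. \<forall>I\<in>?A. P \<subseteq> I \<longrightarrow> I = P"
  proof (rule subset_Zorn_nonempty)
    show "?A \<noteq> {}" using L by blast
    fix C assume C: "C \<noteq> {}" "subset.chain ?A C"
    then have CA: "C \<subseteq> ?A" and tot: "\<And>I J. I \<in> C \<Longrightarrow> J \<in> C \<Longrightarrow> I \<subseteq> J \<or> J \<subseteq> I"
      by (auto simp: subset_chain_def)
    have CI: "left_ideal I R" if "I \<in> C" for I using that CA by auto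
    have U: "left_ideal (\<Union>C) R"
      unfolding left_ideal_iff
    proof (intro conjI ballI)
      show "\<Union>C \<subseteq> carrier R" "\<zero> \<in> \<Union>C"
        using CI C(1) unfolding left_ideal_iff by blast+
      show "a \<oplus> b \<in> \<Union>C" if ab: "a \<in> \<Union>C" "b \<in> \<Union>C" for a b
      proof -
        obtain I where "I \<in> C" "a \<in> I" "b \<in> I" using ab tot by blast
        then show ?thesis using CI unfolding left_ideal_iff by blast
      qed
      show "x \<otimes> a \<in> \<Union>C" if "a \<in> \<Union>C" "x \<in> carrier R" for a x
        using that CI unfolding left_ideal_iff by blast
    qed
    have "\<not> fin_gen_left_ideal R (\<Union>C)"
    proof
      assume "fin_gen_left_ideal R (\<Union>C)"
      then obtain S where S: "finite S" "S \<subseteq> carrier R" "\<Union>C = gen_left_ideal R S"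
        unfolding fin_gen_left_ideal_def by blast
      then have "S \<subseteq> \<Union>C" using gen_left_ideal_superset by simp
      then obtain I where I: "I \<in> C" "S \<subseteq> I"
        using finite_subset_Union_chain[OF S(1) _ C(1) C(2)] by blast
      then have "gen_left_ideal R S \<subseteq> I" using gen_left_ideal_least CI by blast
      then have "I = gen_left_ideal R S" using S(3) I(1) by blast
      then have "fin_gen_left_ideal R I" using S unfolding fin_gen_left_ideal_def by blast
      then show False using I CA by blast
    qed
    moreover have "L \<subseteq> \<Union>C" using C(1) CA by blast
    ultimately show "\<Union>C \<in> ?A" using U by blast
  qed
  then obtain P where "P \<in> ?A" "\<forall>I\<in>?A. P \<subseteq> I \<longrightarrow> I = P" by blast
  then show ?thesis by (intro exI[of _ P]) blast
qed

section \<open>Commutators modulo prime ideals\<close>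

lemma ring_commutator_closed [simp]:
  "x \<in> carrier R \<Longrightarrow> y \<in> carrier R \<Longrightarrow> ring_commutator R x y \<in> carrier R"
  by (simp add: ring_commutator_def)

lemma left_normed_commutator_closed:
  "\<forall>i\<le>n. x i \<in> carrier R \<Longrightarrow> left_normed_commutator R x n \<in> carrier R"
  by (induction n) auto

lemma left_normed_commutator_cong:
  "\<forall>i\<le>n. x i = y i \<Longrightarrow> left_normed_commutator R x n = left_normed_commutator R y n"
  by (induction n) auto

text \<open>Instead of the two-sided ideals generated by \<open>a\<close> and \<open>b\<close>, the
  proof takes annihilators modulo \<open>P\<close>: \<open>?B\<close> consists of all
  \<open>y\<close> with \<open>a R y\<close> inside \<open>P\<close>, and \<open>?A\<close> of all
  \<open>x\<close> with \<open>x R ?B\<close> inside \<open>P\<close>. Both are two-sided ideals,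
  their product lies in \<open>P\<close>, and they contain \<open>b\<close> and \<open>a\<close>
  respectively.\<close>

lemma prime_ideal_elementwise:
  assumes P: "prime_ideal R P" and ab: "a \<in> carrier R" "b \<in> carrier R"
    and arb: "\<And>r. r \<in> carrier R \<Longrightarrow> a \<otimes> r \<otimes> b \<in> P"
  shows "a \<in> P \<or> b \<in> P"
proof -
  have idP: "ideal P R" using P by (simp add: prime_ideal_def)
  then have Pl: "left_ideal P R" and Pr: "\<And>p x. p \<in> P \<Longrightarrow> x \<in> carrier R \<Longrightarrow> p \<otimes> x \<in> P"
    by (auto simp: ideal_iff_left_ideal)
  note Pl' = Pl[unfolded left_ideal_iff]
  let ?B = "{y \<in> carrier R. \<forall>r\<in>carrier R. a \<otimes> r \<otimes> y \<in> P}"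
  let ?A = "{x \<in> carrier R. \<forall>y\<in>?B. \<forall>r\<in>carrier R. x \<otimes> r \<otimes> y \<in> P}"
  have B: "ideal ?B R"
    unfolding ideal_iff_left_ideal left_ideal_iff
  proof (intro conjI ballI)
    fix y x assume y: "y \<in> ?B" and x: "x \<in> carrier R"
    have "a \<otimes> r \<otimes> (x \<otimes> y) \<in> P" if r: "r \<in> carrier R" for r
    proof -
      have "a \<otimes> (r \<otimes> x) \<otimes> y \<in> P" using y x r by blast
      then show ?thesis using ab x y r by (simp add: m_assoc)
    qed
    then show "x \<otimes> y \<in> ?B" using x y by simp
    have "a \<otimes> r \<otimes> (y \<otimes> x) \<in> P" if r: "r \<in> carrier R" for r
    proof -
      have "a \<otimes> r \<otimes> y \<otimes> x \<in> P" using y x r Pr by blast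
      then show ?thesis using ab x y r by (simp add: m_assoc)
    qed
    then show "y \<otimes> x \<in> ?B" using x y by simp
  qed (use Pl' ab in \<open>auto simp: r_distr\<close>)
  have A: "ideal ?A R"
    unfolding ideal_iff_left_ideal left_ideal_iff
  proof (intro conjI ballI)
    fix z x assume z: "z \<in> ?A" and x: "x \<in> carrier R"
    have "x \<otimes> z \<otimes> r \<otimes> y \<in> P" if y: "y \<in> ?B" and r: "r \<in> carrier R" for y r
    proof -
      have "z \<otimes> r \<otimes> y \<in> P" using z y r by blast
      then have "x \<otimes> (z \<otimes> r \<otimes> y) \<in> P" using x Pl' by blast
      then show ?thesis using x y z r by (simp add: m_assoc)
    qed
    then show "x \<otimes> z \<in> ?A" using x z by simp
    have "z \<otimes> x \<otimes> r \<otimes> y \<in> P" if y: "y \<in> ?B" and r: "r \<in> carrier R" for y r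
    proof -
      have "z \<otimes> (x \<otimes> r) \<otimes> y \<in> P" using z y x r by blast
      then show ?thesis using x y z r by (simp add: m_assoc)
    qed
    then show "z \<otimes> x \<in> ?A" using x z by simp
  qed (use Pl' in \<open>auto simp: l_distr\<close>)
  have "?A \<cdot>\<^bsub>R\<^esub> ?B \<subseteq> P"
  proof
    fix z assume "z \<in> ?A \<cdot>\<^bsub>R\<^esub> ?B"
    then show "z \<in> P"
    proof (induction rule: ideal_prod.induct)
      case (prod i j)
      \<comment> \<open>The defining condition of \<open>?A\<close> is used with middle factor
        \<open>\<one>\<close>.\<close>
      then have "i \<otimes> \<one> \<otimes> j \<in> P" by blast
      then show ?case using prod by simp
    next
      case (sum s t)
      then show ?case using Pl' by blast
    qed
  qed
  then have "?A \<subseteq> P \<or> ?B \<subseteq> P" using P A B unfolding prime_ideal_def by blast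
  moreover have "b \<in> ?B" "a \<in> ?A" using ab arb by auto
  ultimately show ?thesis by blast
qed

lemma commutator_descent:
  assumes P: "prime_ideal R P"
    and lie: "\<forall>x. (\<forall>i\<le>Suc (Suc n). x i \<in> carrier R) \<longrightarrow>
      left_normed_commutator R x (Suc (Suc n)) \<in> P"
    and x: "\<forall>i\<le>Suc n. x i \<in> carrier R"
  shows "left_normed_commutator R x (Suc n) \<in> P"
proof -
  have "ideal P R" using P by (simp add: prime_ideal_def)
  then have Pl: "left_ideal P R" and Pr: "\<And>p x. p \<in> P \<Longrightarrow> x \<in> carrier R \<Longrightarrow> p \<otimes> x \<in> P"
    by (auto simp: ideal_iff_left_ideal)
  note Pl' = Pl[unfolded left_ideal_iff]
  define u where "u = left_normed_commutator R x n"
  define y where "y = x (Suc n)"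
  define c where "c = ring_commutator R u y"
  have u: "u \<in> carrier R" unfolding u_def using x left_normed_commutator_closed by auto
  have y: "y \<in> carrier R" using x by (auto simp: y_def)
  have c: "c \<in> carrier R" using u y by (simp add: c_def)
  have gen: "ring_commutator R (ring_commutator R u v) w \<in> P"
    if v: "v \<in> carrier R" and w: "w \<in> carrier R" for v w
  proof -
    \<comment> \<open>Only entries after index \<open>n\<close> change, so the inner commutator is
      still \<open>u\<close>, while the last two entries become arbitrary.\<close>
    let ?z = "x(Suc n := v, Suc (Suc n) := w)"
    have "\<forall>i\<le>Suc (Suc n). ?z i \<in> carrier R" using x v w by (auto simp: le_Suc_eq)
    with lie have "left_normed_commutator R ?z (Suc (Suc n)) \<in> P" by blast
    moreover have "left_normed_commutator R ?z n = u"
      unfolding u_def by (rule left_normed_commutator_cong) auto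
    ultimately show ?thesis by simp
  qed
  have central: "ring_commutator R c r \<in> P" if "r \<in> carrier R" for r
    using gen[OF y that] by (simp add: c_def)
  \<comment> \<open>As \<open>u\<close> commutes with itself, \<open>[u, u y] = u c\<close>; the
    product rule then gives \<open>[u c, y] = u [c, y] + [u, y] c\<close>, whose last term is
    \<open>c c\<close>.\<close>
  have "c \<otimes> c = ring_commutator R (ring_commutator R u (u \<otimes> y)) y \<ominus>
      u \<otimes> ring_commutator R c y"
    unfolding c_def ring_commutator_def using u y by algebra
  also have "\<dots> \<in> P"
    using left_ideal_diff[OF Pl] gen[of "u \<otimes> y" y] central[OF y] Pl' u y by auto
  finally have cc: "c \<otimes> c \<in> P" .
  \<comment> \<open>Primeness is about \<open>c R c\<close>, not about the square alone. Centrality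
    of \<open>c\<close> modulo \<open>P\<close> moves \<open>r\<close> out of the middle, leaving
    \<open>c c r\<close>.\<close>
  have "c \<otimes> r \<otimes> c \<in> P" if r: "r \<in> carrier R" for r
  proof -
    have "c \<otimes> r \<otimes> c = (c \<otimes> c) \<otimes> r \<ominus> c \<otimes> ring_commutator R c r"
      unfolding ring_commutator_def using c r by algebra
    also have "\<dots> \<in> P"
      using left_ideal_diff[OF Pl] Pr[OF cc r] central[OF r] Pl' c by auto
    finally show ?thesis .
  qed
  then have "c \<in> P" using prime_ideal_elementwise[OF P c c] by blast
  then show ?thesis by (simp add: c_def u_def y_def)
qed

lemma commutator_in_prime_ideal:
  assumes "lie_nilpotent R" and P: "prime_ideal R P"
    and xy: "x \<in> carrier R" "y \<in> carrier R"
  shows "ring_commutator R x y \<in> P"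
proof -
  have zero: "\<zero> \<in> P"
    using P by (auto simp: prime_ideal_def ideal_iff_left_ideal left_ideal_iff)
  \<comment> \<open>An index at least 1 is a successor, so the descent can end at
    \<open>Suc 0\<close>, where the left normed commutator is the ordinary commutator of two
    elements. Vanishing is first weakened to membership in \<open>P\<close>, the property that
    descends.\<close>
  obtain m where m: "lie_nilpotent_of_index R (Suc m)"
    using assms(1) unfolding lie_nilpotent_def by (auto dest: Suc_le_D)
  have "\<forall>x. (\<forall>i\<le>Suc m. x i \<in> carrier R) \<longrightarrow> left_normed_commutator R x (Suc m) \<in> P"
    using m zero by (simp add: lie_nilpotent_of_index_def)
  then have "\<forall>x. (\<forall>i\<le>Suc 0. x i \<in> carrier R) \<longrightarrow> left_normed_commutator R x (Suc 0) \<in> P"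
  proof (induction m)
    case (Suc m)
    then show ?case using commutator_descent[OF P] by blast
  qed simp
  from this[rule_format, of "\<lambda>i. if i = 0 then x else y"] xy show ?thesis by simp
qed

section \<open>Commutativity modulo the radical and the conclusion\<close>

lemma commutator_in_prime_radical:
  assumes "lie_nilpotent R" "x \<in> carrier R" "y \<in> carrier R"
  shows "ring_commutator R x y \<in> prime_radical R"
  using assms commutator_in_prime_ideal by (simp add: prime_radical_def)

text \<open>The two products differ by a commutator, which lies in the radical and hence in
  \<open>L\<close>. This replaces commutativity in Cohen's argument.\<close>

lemma left_ideal_mult_swap:
  assumes lie: "lie_nilpotent R" and L: "left_ideal L R" "prime_radical R \<subseteq> L"
    and ab: "a \<in> carrier R" "b \<in> carrier R" "a \<otimes> b \<in> L"
  shows "b \<otimes> a \<in> L"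
proof -
  have "b \<otimes> a = a \<otimes> b \<ominus> ring_commutator R a b"
    unfolding ring_commutator_def using ab by algebra
  also have "\<dots> \<in> L"
    using left_ideal_diff L ab commutator_in_prime_radical[OF lie ab(1,2)] by blast
  finally show ?thesis .
qed

text \<open>Through this implication the hypothesis on all prime ideals yields the one on completely
  prime ideals, so both halves of the theorem reduce to the latter.\<close>

lemma completely_prime_imp_prime:
  assumes P: "completely_prime_ideal R P"
  shows "prime_ideal R P"
  unfolding prime_ideal_def
proof (intro conjI allI impI)
  show "ideal P R" "P \<noteq> carrier R" using P by (auto simp: completely_prime_ideal_def)
  fix A B assume A: "ideal A R" and B: "ideal B R" and AB: "A \<cdot>\<^bsub>R\<^esub> B \<subseteq> P"
  have "A \<subseteq> carrier R" "B \<subseteq> carrier R"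
    using A B by (auto simp: ideal_iff_left_ideal left_ideal_iff)
  moreover have "a \<otimes> b \<in> P" if "a \<in> A" "b \<in> B" for a b
    using AB ideal_prod.prod[OF that] by blast
  ultimately show "A \<subseteq> P \<or> B \<subseteq> P"
    using P unfolding completely_prime_ideal_def by blast
qed

text \<open>If \<open>a b\<close> is in \<open>P\<close> but neither factor is, then
  \<open>P + R a\<close> and the colon ideal of \<open>a\<close> both properly contain
  \<open>P\<close>. By maximality both are finitely generated, and Cohen's step makes
  \<open>P\<close> finitely generated, a contradiction.\<close>

lemma maximal_not_fin_gen_completely_prime:
  assumes lie: "lie_nilpotent R"
    and P: "left_ideal P R" "prime_radical R \<subseteq> P" "\<not> fin_gen_left_ideal R P"
    and maximal: "\<And>I. left_ideal I R \<Longrightarrow> P \<subset> I \<Longrightarrow> fin_gen_left_ideal R I"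
  shows "completely_prime_ideal R P"
  unfolding completely_prime_ideal_def
proof (intro conjI ballI impI)
  note swap = left_ideal_mult_swap[OF lie P(1,2)]
  have PR: "P \<subseteq> carrier R" using P(1) by (simp add: left_ideal_iff)
  have right: "p \<otimes> x \<in> P" if "p \<in> P" "x \<in> carrier R" for p x
    using that P(1) PR swap[of x p] by (auto simp: left_ideal_iff)
  then show "ideal P R" using P(1) by (simp add: ideal_iff_left_ideal)
  show "P \<noteq> carrier R" using P(3) fin_gen_carrier by auto
  fix a b assume ab: "a \<in> carrier R" "b \<in> carrier R" "a \<otimes> b \<in> P"
  show "a \<in> P \<or> b \<in> P"
  proof (rule ccontr)
    assume neg: "\<not> (a \<in> P \<or> b \<in> P)"
    let ?M = "{x \<oplus> r \<otimes> a |x r. x \<in> P \<and> r \<in> carrier R}"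
    let ?J = "{r \<in> carrier R. r \<otimes> a \<in> P}"
    have "x \<in> ?M" if "x \<in> P" for x
    proof -
      have "x = x \<oplus> \<zero> \<otimes> a" using that PR ab by auto
      then show ?thesis using that by blast
    qed
    moreover have "a \<in> ?M"
    proof -
      have "a = \<zero> \<oplus> \<one> \<otimes> a" using ab by simp
      then show ?thesis using P(1) unfolding left_ideal_iff by blast
    qed
    ultimately have "fin_gen_left_ideal R ?M"
      using maximal left_ideal_add_principal[OF P(1) ab(1)] neg by blast
    \<comment> \<open>Right absorption puts \<open>P\<close> inside \<open>?J\<close>. Swapping
      \<open>a b\<close> to \<open>b a\<close> puts \<open>b\<close> in \<open>?J\<close>, and
      \<open>b\<close> is outside \<open>P\<close>.\<close>
    moreover have "P \<subset> ?J" using PR right swap ab neg by blast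
    then have "fin_gen_left_ideal R ?J"
      using maximal left_ideal_colon[OF P(1) ab(1)] by blast
    ultimately show False
      using fin_gen_of_add_principal_and_colon[OF P(1) ab(1)] P(3) by blast
  qed
qed

lemma fin_gen_of_completely_prime_fin_gen:
  assumes "lie_nilpotent R"
    and "\<And>P. completely_prime_ideal R P \<Longrightarrow> fin_gen_left_ideal R P"
    and "left_ideal L R" "prime_radical R \<subseteq> L"
  shows "fin_gen_left_ideal R L"
proof (rule ccontr)
  assume "\<not> fin_gen_left_ideal R L"
  then obtain P where P: "left_ideal P R" "L \<subseteq> P" "\<not> fin_gen_left_ideal R P"
    "\<And>I. left_ideal I R \<Longrightarrow> P \<subset> I \<Longrightarrow> fin_gen_left_ideal R I"
    using exists_maximal_not_fin_gen[OF assms(3)] by blast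
  then have "completely_prime_ideal R P"
    using maximal_not_fin_gen_completely_prime[OF assms(1)] assms(4) by blast
  then show False using assms(2) P(3) by blast
qed

end

theorem theorem3p3:
  fixes R :: "('a, 'b) ring_scheme"
  assumes "ring R"
    and "lie_nilpotent R"
  shows "((\<forall>P. prime_ideal R P \<longrightarrow> fin_gen_left_ideal R P) \<longrightarrow>
            (\<forall>L. left_ideal L R \<and> prime_radical R \<subseteq> L \<longrightarrow> fin_gen_left_ideal R L)) \<and>
         ((\<forall>P. completely_prime_ideal R P \<longrightarrow> fin_gen_left_ideal R P) \<longrightarrow>
            (\<forall>L. left_ideal L R \<and> prime_radical R \<subseteq> L \<longrightarrow> fin_gen_left_ideal R L))"
  using ring.fin_gen_of_completely_prime_fin_gen[OF assms]
    ring.completely_prime_imp_prime[OF assms(1)] by blast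

end
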